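(* For every $r\in(0,1)$, $$\|\eta_r\|_{B(\phi_R)}=g(r),\qquad\text{where}\quad g(r)=\sup_{\lambda\neq 0}\left[\frac{\cosh^{-1}\left(r e^{\lambda(1-r)}+(1-r)e^{-r\lambda}\right)}{|\lambda|/2}\right].$$
   Context: For $r\in(0,1)$, $\eta_r$ denotes the centered indicator (binary) random variable with $\mathbf P(\eta_r=1-r)=r$ and $\mathbf P(\eta_r=-r)=1-r$. Let $\phi_R(\lambda)=\ln\cosh(\lambda/2)$, $\lambda\in\mathbb R$. For a centered random variable $\xi$, the norm $\|\xi\|_{B(\phi_R)}$ (the "Rademacher norm") is $$\|\xi\|_{B(\phi_R)}=\inf\left\{\tau>0:\ \forall\lambda\in\mathbb R\quad \mathbf E\exp(\lambda\xi)\le\exp\left(\phi_R(\lambda\tau)\right)\right\}.$$ For $z\ge1$, $\cosh^{-1}z=\ln\left(z+\sqrt{z^2-1}\right)$ is the nonnegative branch of the inverse hyperbolic cosine. *)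

theory Defs
  imports "HOL-Probability.Probability"
begin

definition phi_R :: "real \<Rightarrow> real" where
  "phi_R t = ln (cosh (t / 2))"

text \<open>The norm takes values in the extended reals, so that it is \<open>\<infinity>\<close> if no \<open>\<tau>\<close> is
  admissible. Integrability is required explicitly because the Bochner integral of a
  non-integrable function is 0, whereas the expectation of the positive random variable
  \<open>exp (t * \<xi>)\<close> is then infinite.\<close>

definition B_norm :: "(real \<Rightarrow> real) \<Rightarrow> 'a measure \<Rightarrow> ('a \<Rightarrow> real) \<Rightarrow> ereal" where
  "B_norm \<phi> M \<xi> = Inf (ereal ` {\<tau>. \<tau> > 0 \<and>
     (\<forall>t::real. integrable M (\<lambda>\<omega>. exp (t * \<xi> \<omega>)) \<and>
        integral\<^sup>L M (\<lambda>\<omega>. exp (t * \<xi> \<omega>)) \<le> exp (\<phi> (t * \<tau>)))})"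

definition centered_indicator :: "'a measure \<Rightarrow> real \<Rightarrow> ('a \<Rightarrow> real) \<Rightarrow> bool" where
  "centered_indicator M r \<eta> \<longleftrightarrow>
     \<eta> \<in> borel_measurable M \<and>
     measure M {\<omega> \<in> space M. \<eta> \<omega> = 1 - r} = r \<and>
     measure M {\<omega> \<in> space M. \<eta> \<omega> = - r} = 1 - r"

definition g :: "real \<Rightarrow> ereal" where
  "g r = (SUP t\<in>UNIV - {0::real}.
     ereal (arcosh (r * exp (t * (1 - r)) + (1 - r) * exp (- r * t)) / (\<bar>t\<bar> / 2)))"

end

theory Submission
  imports Defs
begin

text \<open>Since \<open>exp (phi_R u) = cosh (u / 2)\<close>, a number \<open>\<tau> > 0\<close> is admissible in the norm exactly
  when the moment generating function \<open>m t\<close> of \<open>\<eta>\<close> stays below \<open>cosh (t * \<tau> / 2)\<close>. The constraint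
  is void at \<open>t = 0\<close>. For \<open>t \<noteq> 0\<close> both sides are at least \<open>1\<close>, so the increasing branch of
  \<open>cosh\<close> can be inverted, and the constraint becomes
  \<open>arcosh (m t) / (\<bar>t\<bar> / 2) \<le> \<tau>\<close>. Hence the admissible numbers are the positive upper bounds
  of the family whose supremum is \<open>g r\<close>. This supremum is nonnegative, so it is
  in turn the infimum of its positive real upper bounds.\<close>

lemma exp_phi_R: "exp (phi_R u) = cosh (u / 2)"
  by (simp add: phi_R_def cosh_real_pos)

text \<open>If \<open>x = \<infinity>\<close>, then the set is empty and its infimum is \<open>\<infinity>\<close> as well. If \<open>x\<close> is \<open>0\<close>, then
  the infimum is not attained, which is why the proof approaches \<open>x\<close> from above.\<close>

lemma Inf_positive_real_upper_bounds:
  fixes x :: ereal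
  assumes "0 \<le> x"
  shows "Inf (ereal ` {\<tau>. \<tau> > 0 \<and> x \<le> ereal \<tau>}) = x"
proof (rule antisym)
  show "x \<le> Inf (ereal ` {\<tau>. \<tau> > 0 \<and> x \<le> ereal \<tau>})"
    by (auto intro: Inf_greatest)
  show "Inf (ereal ` {\<tau>. \<tau> > 0 \<and> x \<le> ereal \<tau>}) \<le> x"
  proof (rule dense_ge)
    fix y assume "x < y"
    then obtain z where z: "x < ereal z" "ereal z < y"
      using ereal_dense2 by blast
    have "0 < ereal z"
      using assms z(1) by (rule le_less_trans)
    then have "Inf (ereal ` {\<tau>. \<tau> > 0 \<and> x \<le> ereal \<tau>}) \<le> ereal z"
      using z(1) by (intro Inf_lower) auto
    then show "Inf (ereal ` {\<tau>. \<tau> > 0 \<and> x \<le> ereal \<tau>}) \<le> y"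
      using z(2) by simp
  qed
qed

lemma le_cosh_iff_arcosh_div_le:
  fixes m t \<tau> :: real
  assumes "1 \<le> m" "t \<noteq> 0" "0 < \<tau>"
  shows "m \<le> cosh (t * \<tau> / 2) \<longleftrightarrow> arcosh m / (\<bar>t\<bar> / 2) \<le> \<tau>"
proof -
  have "cosh (t * \<tau> / 2) = cosh \<bar>t * \<tau> / 2\<bar>"
    by (simp only: cosh_real_abs)
  also have "\<bar>t * \<tau> / 2\<bar> = \<tau> * (\<bar>t\<bar> / 2)"
    using assms(3) by (simp add: abs_mult)
  finally have "cosh (t * \<tau> / 2) = cosh (\<tau> * (\<bar>t\<bar> / 2))" .
  then have "m \<le> cosh (t * \<tau> / 2) \<longleftrightarrow> cosh (arcosh m) \<le> cosh (\<tau> * (\<bar>t\<bar> / 2))"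
    using assms(1) by (simp only: cosh_arcosh_real)
  also have "\<dots> \<longleftrightarrow> arcosh m \<le> \<tau> * (\<bar>t\<bar> / 2)"
    using assms by (intro cosh_real_nonneg_le_iff) auto
  also have "\<dots> \<longleftrightarrow> arcosh m / (\<bar>t\<bar> / 2) \<le> \<tau>"
    using assms(2) by (simp add: pos_divide_le_eq)
  finally show ?thesis .
qed

text \<open>The two atoms carry the total mass \<open>1\<close>, so \<open>\<eta>\<close> takes no other value almost surely and
  every function of \<open>\<eta>\<close> agrees almost everywhere with a combination of two indicators.\<close>

lemma centered_indicator_mgf:
  fixes M :: "'a measure" and \<eta> :: "'a \<Rightarrow> real"
  assumes "prob_space M" and "centered_indicator M r \<eta>"
  shows "has_bochner_integral M (\<lambda>\<omega>. exp (t * \<eta> \<omega>))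
           (r * exp (t * (1 - r)) + (1 - r) * exp (- r * t))"
proof -
  interpret prob_space M by fact
  define A where "A = {\<omega> \<in> space M. \<eta> \<omega> = 1 - r}"
  define B where "B = {\<omega> \<in> space M. \<eta> \<omega> = - r}"
  have meas [measurable]: "\<eta> \<in> borel_measurable M"
    and AB: "prob A = r" "prob B = 1 - r"
    using assms(2) by (auto simp: centered_indicator_def A_def B_def)
  have [measurable]: "A \<in> events" "B \<in> events"
    unfolding A_def B_def by measurable
  have "A \<inter> B = {}"
    by (auto simp: A_def B_def)
  then have "prob (A \<union> B) = 1"
    using AB by (subst finite_measure_Union) auto
  then have "AE \<omega> in M. \<omega> \<in> A \<union> B"
    by (intro AE_prob_1)
  then have ae: "AE \<omega> in M. indicator A \<omega> * exp (t * (1 - r)) + indicator B \<omega> * exp (- r * t)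
      = exp (t * \<eta> \<omega>)"
    by eventually_elim (auto simp: A_def B_def mult.commute)
  have "has_bochner_integral M
      (\<lambda>\<omega>. indicator A \<omega> * exp (t * (1 - r)) + indicator B \<omega> * exp (- r * t))
      (prob A * exp (t * (1 - r)) + prob B * exp (- r * t))"
    by (intro has_bochner_integral_add has_bochner_integral_mult_left
          has_bochner_integral_real_indicator) (auto simp: emeasure_eq_measure)
  then show ?thesis
    using ae unfolding AB
    by (subst (asm) has_bochner_integral_cong_AE) auto
qed

text \<open>This is Jensen's inequality for a variable of mean zero, obtained by averaging the tangent
  bound \<open>1 + x \<le> exp x\<close> over the two atoms.\<close>

lemma centered_indicator_mgf_ge_1:
  fixes r t :: real
  assumes "0 < r" "r < 1"
  shows "1 \<le> r * exp (t * (1 - r)) + (1 - r) * exp (- r * t)"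
proof -
  have "1 = r * (1 + t * (1 - r)) + (1 - r) * (1 + (- r * t))"
    by (simp add: algebra_simps)
  also have "\<dots> \<le> r * exp (t * (1 - r)) + (1 - r) * exp (- r * t)"
    using assms by (intro add_mono mult_left_mono exp_ge_add_one_self) auto
  finally show ?thesis .
qed

theorem proposition2p1:
  fixes M :: "'a measure" and \<eta> :: "'a \<Rightarrow> real" and r :: real
  assumes "prob_space M"
    and "0 < r" and "r < 1"
    and "centered_indicator M r \<eta>"
  shows "B_norm phi_R M \<eta> = g r"
proof -
  define m where "m t = r * exp (t * (1 - r)) + (1 - r) * exp (- r * t)" for t
  have m_ge_1: "1 \<le> m t" for t
    using centered_indicator_mgf_ge_1 assms(2,3) unfolding m_def .
  have "has_bochner_integral M (\<lambda>\<omega>. exp (t * \<eta> \<omega>)) (m t)" for t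
    using centered_indicator_mgf assms(1,4) unfolding m_def .
  then have mgf: "integrable M (\<lambda>\<omega>. exp (t * \<eta> \<omega>))"
      "integral\<^sup>L M (\<lambda>\<omega>. exp (t * \<eta> \<omega>)) = m t" for t
    by (auto simp: has_bochner_integral_iff)
  have g_eq: "g r = (SUP t\<in>UNIV - {0}. ereal (arcosh (m t) / (\<bar>t\<bar> / 2)))"
    by (simp add: g_def m_def)
  have admissible_iff: "(\<forall>t. m t \<le> cosh (t * \<tau> / 2)) \<longleftrightarrow> g r \<le> ereal \<tau>" if "0 < \<tau>" for \<tau>
  proof -
    have "m 0 = 1"
      by (simp add: m_def)
    then have "(\<forall>t. m t \<le> cosh (t * \<tau> / 2)) \<longleftrightarrow> (\<forall>t\<in>UNIV - {0}. m t \<le> cosh (t * \<tau> / 2))"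
      by force
    also have "\<dots> \<longleftrightarrow> (\<forall>t\<in>UNIV - {0}. arcosh (m t) / (\<bar>t\<bar> / 2) \<le> \<tau>)"
      using le_cosh_iff_arcosh_div_le [OF m_ge_1 _ that] by auto
    also have "\<dots> \<longleftrightarrow> g r \<le> ereal \<tau>"
      by (simp add: g_eq SUP_le_iff)
    finally show ?thesis .
  qed
  have "0 \<le> ereal (arcosh (m 1) / (\<bar>1\<bar> / 2))"
    using m_ge_1 by simp
  also have "\<dots> \<le> g r"
    unfolding g_eq by (rule SUP_upper) simp
  finally have "0 \<le> g r" .
  have "B_norm phi_R M \<eta> = Inf (ereal ` {\<tau>. \<tau> > 0 \<and> (\<forall>t. m t \<le> cosh (t * \<tau> / 2))})"
    by (simp add: B_norm_def mgf exp_phi_R)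
  also have "\<dots> = Inf (ereal ` {\<tau>. \<tau> > 0 \<and> g r \<le> ereal \<tau>})"
    using admissible_iff by (metis (no_types, lifting))
  also have "\<dots> = g r"
    using \<open>0 \<le> g r\<close> by (rule Inf_positive_real_upper_bounds)
  finally show ?thesis .
qed

end
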